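(* Let $\beta,\lambda$ be real numbers with $\lambda\ge\beta>0$ (so that $0\le 1-\frac{\beta^2}{\lambda^2}<1$), and let $s\in\mathbb{C}$. Then $$\int_{-\pi}^{\pi}\left(\frac{\cos^2\theta}{\beta^2}+\frac{\sin^2\theta}{\lambda^2}\right)^{s}d\theta=\frac{2\pi\beta}{\lambda^{1+2s}}\;{}_2F_1\left(\tfrac12,\,1+s;\,1;\,1-\frac{\beta^2}{\lambda^2}\right).$$
   Context: Powers of positive real numbers are $x^{s}=e^{s\ln x}$. The Gauss hypergeometric function is ${}_2F_1(a,b;c;z)=\sum_{n=0}^{\infty}\frac{(a)_n(b)_n}{(c)_n\,n!}z^n$ for $|z|<1$, where $(a)_0=1$ and $(a)_n=a(a+1)\cdots(a+n-1)$ for $n\ge1$. *)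

theory Defs
  imports "HOL-Analysis.Analysis"
begin

text \<open>
  The Gauss hypergeometric series. It is meant for \<^term>\<open>norm z < 1\<close> and for \<^term>\<open>c\<close> not a
  non-positive integer. Outside this range \<^term>\<open>suminf\<close> and division by zero give unspecified or
  conventional values; inside it the series converges, see \<open>hypergeo_2F1_sums\<close> below.
\<close>
definition hypergeo_2F1 :: "complex \<Rightarrow> complex \<Rightarrow> complex \<Rightarrow> complex \<Rightarrow> complex" where
  "hypergeo_2F1 a b c z =
     (\<Sum>n. pochhammer a n * pochhammer b n / (pochhammer c n * fact n) * z ^ n)"

lemma hypergeo_2F1_sums:
  assumes c: "c \<notin> \<int>\<^sub>\<le>\<^sub>0" and z: "norm z < 1"
  shows "(\<lambda>n. pochhammer a n * pochhammer b n / (pochhammer c n * fact n) * z ^ n)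
           sums hypergeo_2F1 a b c z"
proof -
  let ?f = "\<lambda>n. pochhammer a n * pochhammer b n / (pochhammer c n * fact n) * z ^ n"
  define q where "q = (\<lambda>n. (a + of_nat n) * (b + of_nat n) / ((c + of_nat n) * (1 + of_nat n)) * z)"
  have nz: "c + of_nat n \<noteq> 0" for n
    using c by (metis add_eq_0_iff2 minus_of_nat_in_nonpos_Ints)
  have step: "?f (Suc n) = q n * ?f n" for n
    by (simp add: q_def pochhammer_Suc mult_ac)
  have shift: "((\<lambda>n. d / of_nat n) \<longlonglongrightarrow> 0)" for d :: complex
    by (rule lim_const_over_n)
  have lim: "(\<lambda>n. (1 + a / of_nat n) * (1 + b / of_nat n) /
      ((1 + c / of_nat n) * (1 + 1 / of_nat n)) * z) \<longlonglongrightarrow> (1 + 0) * (1 + 0) / ((1 + 0) * (1 + 0)) * z"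
    by (intro tendsto_intros shift) auto
  have ev: "\<forall>\<^sub>F n in sequentially. (1 + a / of_nat n) * (1 + b / of_nat n) /
      ((1 + c / of_nat n) * (1 + 1 / of_nat n)) * z = q n"
    using eventually_gt_at_top[of 0]
  proof eventually_elim
    case (elim n)
    have "1 + d / of_nat n = (d + of_nat n) / (of_nat n :: complex)" for d
      using elim by (simp add: field_simps)
    then show ?case using elim by (simp add: q_def)
  qed
  from Lim_transform_eventually[OF lim ev] have "q \<longlonglongrightarrow> z"
    by simp
  then have "(\<lambda>n. norm (q n)) \<longlonglongrightarrow> norm z"
    by (rule tendsto_norm)
  moreover obtain r where r: "norm z < r" "r < 1"
    using z dense by blast
  ultimately have "\<forall>\<^sub>F n in sequentially. norm (q n) < r"
    by (metis order_tendstoD(2))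
  then obtain N where N: "\<And>n. n \<ge> N \<Longrightarrow> norm (q n) < r"
    by (auto simp: eventually_sequentially)
  have "summable ?f"
  proof (rule summable_ratio_test)
    show "r < 1" by fact
    show "norm (?f (Suc n)) \<le> r * norm (?f n)" if "n \<ge> N" for n
      unfolding step norm_mult[of "q n"]
      using N[OF that] by (intro mult_right_mono) auto
  qed
  then show ?thesis
    unfolding hypergeo_2F1_def by (rule summable_sums)
qed

end

theory Submission
  imports Defs
begin

text \<open>
  The substitution \<open>\<beta> tan \<theta> = \<lambda> tan \<phi>\<close> turns the integrand, up to a constant factor, into
  \<open>(1 - k cos\<^sup>2 \<phi>) powr (-1 - s)\<close> with \<open>k = 1 - \<beta>\<^sup>2 / \<lambda>\<^sup>2\<close>. Expanding this by the binomial series and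
  integrating term by term with the Wallis integrals yields the hypergeometric series with the
  parameters of the theorem, so that no transformation formula for hypergeometric functions is needed.
\<close>

section \<open>Wallis integrals and termwise integration of the binomial series\<close>

text \<open>The Wallis recursion: the derivative of \<open>sin x * cos x ^ (2 * n + 1)\<close> is a
  combination of two consecutive even powers of the cosine, and the function itself vanishes at both
  ends of the interval.\<close>

lemma has_integral_cos_power_even:
  "((\<lambda>x::real. cos x ^ (2 * n)) has_integral 2 * pi * pochhammer (1/2) n / fact n) {-pi..pi}"
proof (induction n)
  case 0
  then show ?case
    using has_integral_const_real[of "1::real" "-pi" pi] by simp
next
  case (Suc n)
  let ?c = "2 * real n + 1" and ?d = "2 * real n + 2"
  have deriv: "((\<lambda>x. sin x * cos x ^ (2 * n + 1)) has_vector_derivative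
      ?d * cos x ^ (2 * Suc n) - ?c * cos x ^ (2 * n)) (at x within {-pi..pi})" for x :: real
  proof -
    have "((\<lambda>x. sin x * cos x ^ (2 * n + 1)) has_real_derivative
        cos x * cos x ^ (2 * n + 1) - ?c * (sin x)\<^sup>2 * cos x ^ (2 * n)) (at x within {-pi..pi})"
      by (rule derivative_eq_intros refl)+ (simp add: power2_eq_square algebra_simps)
    moreover have "cos x * cos x ^ (2 * n + 1) - ?c * (sin x)\<^sup>2 * cos x ^ (2 * n)
        = ?d * cos x ^ (2 * Suc n) - ?c * cos x ^ (2 * n)"
      unfolding sin_squared_eq by (simp add: algebra_simps power2_eq_square)
    ultimately show ?thesis
      by (simp add: has_real_derivative_iff_has_vector_derivative)
  qed
  have "((\<lambda>x. ?d * cos x ^ (2 * Suc n) - ?c * cos x ^ (2 * n)) has_integral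
      sin pi * cos pi ^ (2 * n + 1) - sin (-pi) * cos (-pi) ^ (2 * n + 1)) {-pi..pi}"
    by (rule fundamental_theorem_of_calculus) (use deriv in auto)
  from has_integral_add[OF this has_integral_mult_right[OF Suc.IH, of ?c]]
  have "((\<lambda>x. ?d * cos x ^ (2 * Suc n)) has_integral
      ?c * (2 * pi * pochhammer (1/2) n / fact n)) {-pi..pi}"
    by simp
  from has_integral_mult_right[OF this, of "1 / ?d"]
  have "((\<lambda>x. cos x ^ (2 * Suc n)) has_integral
      ?c * (2 * pi * pochhammer (1/2) n / fact n) / ?d) {-pi..pi}"
    by (simp add: add_nonneg_eq_0_iff mult.commute)
  moreover have "?c * (2 * pi * pochhammer (1/2) n / fact n) / ?d
      = 2 * pi * pochhammer (1/2) (Suc n) / fact (Suc n)"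
    by (simp add: pochhammer_Suc divide_simps add_nonneg_eq_0_iff) (simp add: algebra_simps)
  ultimately show ?case by simp
qed

text \<open>Newton's series with exponent \<open>- a\<close> at \<open>- z\<close>: the sign in the
  generalised binomial coefficient cancels the one in \<open>(- z) ^ n\<close>.\<close>

lemma binomial_series_neg_powr:
  fixes a z :: complex
  assumes "norm z < 1"
  shows "(\<lambda>n. pochhammer a n / fact n * z ^ n) sums (1 - z) powr (- a)"
proof -
  have "((- a) gchoose n) * (- z) ^ n = pochhammer a n / fact n * z ^ n" for n
    by (simp add: gbinomial_pochhammer power_minus[of z] mult_ac)
  then show ?thesis
    using gen_binomial_complex[of "- z" "- a"] assms by simp
qed

text \<open>The terms of the binomial series in \<open>k * (cos x)^2\<close> are bounded, uniformly
  in \<open>x\<close>, by the absolute values of the terms at \<open>k\<close>, so termwise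
  integration is allowed. The Wallis integrals supply the parameters 1/2 and 1.\<close>

lemma has_integral_one_minus_cos_squared_powr:
  fixes k :: real and a :: complex
  assumes "0 \<le> k" "k < 1"
  shows "((\<lambda>x. complex_of_real (1 - k * (cos x)\<^sup>2) powr (- a)) has_integral
      2 * complex_of_real pi * hypergeo_2F1 (1/2) a 1 (complex_of_real k)) {-pi..pi}"
proof -
  define c where "c n = pochhammer a n / fact n" for n
  define f where "f n x = c n * complex_of_real (k * (cos x)\<^sup>2) ^ n" for n and x :: real
  define M where "M n = norm (c n * complex_of_real k ^ n)" for n
  \<comment> \<open>Convergence at a point strictly beyond \<open>k\<close> gives absolute
    convergence at \<open>k\<close>.\<close>
  obtain K where K: "k < K" "K < 1" using assms dense by blast
  have "summable (\<lambda>n. c n * complex_of_real K ^ n)"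
    using binomial_series_neg_powr[of "complex_of_real K" a] K assms
    by (auto simp: c_def sums_iff)
  then have "summable M"
    unfolding M_def by (rule powser_insidea) (use K assms in auto)
  have cos_le: "(cos x)\<^sup>2 \<le> 1" for x :: real
    by (simp add: abs_square_le_1)
  have bound: "norm (f n x) \<le> M n" for n x
  proof -
    have "(k * (cos x)\<^sup>2) ^ n \<le> k ^ n"
      by (rule power_mono) (use assms cos_le[of x] in \<open>auto simp: mult_left_le\<close>)
    then show ?thesis
      using assms unfolding f_def M_def norm_mult norm_power norm_of_real
      by (intro mult_left_mono) auto
  qed
  have suminf_f: "(\<Sum>n. f n x) = complex_of_real (1 - k * (cos x)\<^sup>2) powr (- a)" for x
  proof -
    have "k * (cos x)\<^sup>2 < 1"
      using assms cos_le[of x] by (meson mult_left_le order.strict_trans1)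
    then have "norm (complex_of_real (k * (cos x)\<^sup>2)) < 1"
      using assms unfolding norm_of_real by auto
    from binomial_series_neg_powr[OF this, of a] show ?thesis
      by (simp add: f_def c_def sums_iff)
  qed
  have "uniform_limit {-pi..pi} (\<lambda>n x. \<Sum>i<n. f i x) (\<lambda>x. \<Sum>n. f n x) sequentially"
    by (rule Weierstrass_m_test[OF bound \<open>summable M\<close>])
  then obtain I J where I: "\<And>n. ((\<lambda>x. \<Sum>i<n. f i x) has_integral I n) {-pi..pi}"
    and J: "((\<lambda>x. \<Sum>n. f n x) has_integral J) {-pi..pi}" and "I \<longlonglongrightarrow> J"
    by (rule uniform_limit_integral) (auto simp: f_def intro!: continuous_intros)
  \<comment> \<open>The binomial series and the Wallis integral each bring a factorial; one of them
    is written as \<open>pochhammer 1 n\<close> to match the hypergeometric series.\<close>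
  define t where "t n = 2 * complex_of_real pi *
    (pochhammer (1/2) n * pochhammer a n / (pochhammer 1 n * fact n) * complex_of_real k ^ n)" for n
  have "(f n has_integral t n) {-pi..pi}" for n
  proof -
    have "((\<lambda>x. complex_of_real (cos x ^ (2 * n))) has_integral
        complex_of_real (2 * pi * pochhammer (1/2) n / fact n)) {-pi..pi}"
      by (rule has_integral_of_real[OF has_integral_cos_power_even])
    from has_integral_mult_right[OF this, of "c n * complex_of_real k ^ n"]
    show ?thesis
      by (simp add: f_def[abs_def] c_def t_def power_mult_distrib mult_ac
          pochhammer_of_real[symmetric] pochhammer_fact[symmetric] flip: power_mult)
  qed
  then have "((\<lambda>x. \<Sum>i<n. f i x) has_integral (\<Sum>i<n. t i)) {-pi..pi}" for n
    by (intro has_integral_sum) auto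
  then have "I = (\<lambda>n. \<Sum>i<n. t i)"
    using I has_integral_unique by blast
  then have "t sums J"
    using \<open>I \<longlonglongrightarrow> J\<close> by (simp add: sums_def)
  moreover have "t sums (2 * complex_of_real pi * hypergeo_2F1 (1/2) a 1 (complex_of_real k))"
    unfolding t_def by (intro sums_mult hypergeo_2F1_sums) (use assms in auto)
  ultimately have "J = 2 * complex_of_real pi * hypergeo_2F1 (1/2) a 1 (complex_of_real k)"
    by (rule sums_unique2)
  then show ?thesis
    using J by (simp add: suminf_f)
qed

section \<open>The change of variable and its derivative\<close>

text \<open>
  The solution \<open>\<theta>\<close> of \<open>tan \<theta> = r tan \<phi>\<close> on the branch through the multiples of \<open>\<pi>/2\<close>. Writing it
  as \<open>\<phi>\<close> plus a correction makes it smooth on the whole line.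
\<close>
definition stretch_angle :: "real \<Rightarrow> real \<Rightarrow> real" where
  "stretch_angle r x = x + arctan ((r - 1) * sin x * cos x / ((cos x)\<^sup>2 + r * (sin x)\<^sup>2))"

lemma cos_sin_squares_pos:
  fixes r x :: real
  assumes "r > 0"
  shows "(cos x)\<^sup>2 + r * (sin x)\<^sup>2 > 0"
proof (cases "cos x = 0")
  case True
  then show ?thesis
    using assms sin_cos_squared_add[of x] by simp
qed (use assms in \<open>simp add: add_pos_nonneg\<close>)

context
  fixes r x :: real
  assumes r: "r > 0"
begin

text \<open>Both sides are the squared modulus of
  \<open>(cos x + i * r * sin x) * (cos x - i * sin x)\<close>: the left side through its real and
  imaginary parts, the right side because the second factor has modulus 1.\<close>

lemma stretch_angle_denominator:
  "((cos x)\<^sup>2 + r * (sin x)\<^sup>2)\<^sup>2 + ((r - 1) * sin x * cos x)\<^sup>2 = (cos x)\<^sup>2 + r\<^sup>2 * (sin x)\<^sup>2"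
  by (simp add: power_mult_distrib cos_squared_eq) (simp add: power2_eq_square algebra_simps)

text \<open>The arctangent is the argument of that product, whose real part is positive; adding
  \<open>x\<close> gives an argument of \<open>cos x + i * r * sin x\<close>.\<close>

lemma cos_sin_stretch_angle:
  shows "cos (stretch_angle r x) = cos x / sqrt ((cos x)\<^sup>2 + r\<^sup>2 * (sin x)\<^sup>2)"
    and "sin (stretch_angle r x) = r * sin x / sqrt ((cos x)\<^sup>2 + r\<^sup>2 * (sin x)\<^sup>2)"
proof -
  define X Y D where "X = (cos x)\<^sup>2 + r * (sin x)\<^sup>2" and "Y = (r - 1) * sin x * cos x"
    and "D = sqrt ((cos x)\<^sup>2 + r\<^sup>2 * (sin x)\<^sup>2)"
  have X: "X > 0" unfolding X_def by (rule cos_sin_squares_pos[OF r])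
  have D: "D > 0" unfolding D_def using cos_sin_squares_pos[of "r\<^sup>2" x] r by simp
  have DXY: "X\<^sup>2 + Y\<^sup>2 = D\<^sup>2"
    unfolding X_def Y_def D_def stretch_angle_denominator
    using cos_sin_squares_pos[of "r\<^sup>2" x] r by simp
  have "1 + (Y / X)\<^sup>2 = (D / X)\<^sup>2"
    using X DXY by (simp add: field_simps)
  then have sqrt: "sqrt (1 + (Y / X)\<^sup>2) = D / X"
    using X D by simp
  have arctan: "cos (arctan (Y / X)) = X / D" "sin (arctan (Y / X)) = Y / D"
    unfolding cos_arctan sin_arctan sqrt using X by simp_all
  have angle: "stretch_angle r x = x + arctan (Y / X)"
    by (simp add: stretch_angle_def X_def Y_def)
  \<comment> \<open>Real part of
    \<open>(cos x + i * sin x) * (X + i * Y) = cos x + i * r * sin x\<close>; the imaginary part is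
    used for the sine.\<close>
  have "cos x * X - sin x * Y = cos x"
    by (simp add: X_def Y_def sin_squared_eq algebra_simps power2_eq_square)
       (simp add: sin_squared_eq algebra_simps flip: power2_eq_square mult.assoc)
  then show "cos (stretch_angle r x) = cos x / sqrt ((cos x)\<^sup>2 + r\<^sup>2 * (sin x)\<^sup>2)"
    using X D by (simp add: angle cos_add arctan D_def[symmetric] field_simps)
  have "sin x * X + cos x * Y = r * sin x"
    by (simp add: X_def Y_def cos_squared_eq algebra_simps power2_eq_square)
       (simp add: cos_squared_eq algebra_simps flip: power2_eq_square mult.assoc)
  then show "sin (stretch_angle r x) = r * sin x / sqrt ((cos x)\<^sup>2 + r\<^sup>2 * (sin x)\<^sup>2)"
    using X D by (simp add: angle sin_add arctan D_def[symmetric] field_simps)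
qed

text \<open>The polar angle of a moving point \<open>(u, v)\<close> has derivative
  \<open>(u * v' - u' * v) / (u^2 + v^2)\<close>; for \<open>u = cos x\<close> and
  \<open>v = r * sin x\<close> the numerator is \<open>r\<close>.\<close>

lemma DERIV_stretch_angle:
  "(stretch_angle r has_real_derivative r / ((cos x)\<^sup>2 + r\<^sup>2 * (sin x)\<^sup>2)) (at x within A)"
proof -
  define X Y D where "X = (cos x)\<^sup>2 + r * (sin x)\<^sup>2" and "Y = (r - 1) * sin x * cos x"
    and "D = (cos x)\<^sup>2 + r\<^sup>2 * (sin x)\<^sup>2"
  define X' Y' where "X' = 2 * (r - 1) * sin x * cos x"
    and "Y' = (r - 1) * ((cos x)\<^sup>2 - (sin x)\<^sup>2)"
  have X: "X > 0" unfolding X_def by (rule cos_sin_squares_pos[OF r])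
  have D: "D > 0" unfolding D_def using cos_sin_squares_pos[of "r\<^sup>2" x] r by simp
  have DXY: "X\<^sup>2 + Y\<^sup>2 = D"
    unfolding X_def Y_def D_def by (rule stretch_angle_denominator)
  have dX: "((\<lambda>x. (cos x)\<^sup>2 + r * (sin x)\<^sup>2) has_real_derivative X') (at x within A)"
    unfolding X'_def by (auto intro!: derivative_eq_intros simp: algebra_simps)
  have dY: "((\<lambda>x. (r - 1) * sin x * cos x) has_real_derivative Y') (at x within A)"
    unfolding Y'_def by (auto intro!: derivative_eq_intros simp: algebra_simps power2_eq_square)
  have "((\<lambda>x. (r - 1) * sin x * cos x / ((cos x)\<^sup>2 + r * (sin x)\<^sup>2)) has_real_derivative
      (Y' * X - Y * X') / (X * X)) (at x within A)"
    using DERIV_divide[OF dY dX] X by (simp add: X_def Y_def)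
  from DERIV_chain2[OF DERIV_arctan this]
  have "(stretch_angle r has_real_derivative
      1 + inverse (1 + (Y / X)\<^sup>2) * ((Y' * X - Y * X') / (X * X))) (at x within A)"
    unfolding stretch_angle_def[abs_def] X_def[symmetric] Y_def[symmetric]
    by (intro DERIV_add DERIV_ident) (simp add: X_def Y_def)
  moreover have "1 + (Y / X)\<^sup>2 = D / X\<^sup>2"
    using X DXY by (simp add: field_simps)
  then have "1 + inverse (1 + (Y / X)\<^sup>2) * ((Y' * X - Y * X') / (X * X))
      = (D + (Y' * X - Y * X')) / D"
    using X D by (simp add: power2_eq_square add_divide_distrib)
  moreover have "D + (Y' * X - Y * X') = r"
  proof -
    have "Y * X' = 2 * (r - 1)\<^sup>2 * (sin x)\<^sup>2 * (cos x)\<^sup>2"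
      by (simp add: Y_def X'_def power2_eq_square)
    then show ?thesis
      by (simp add: D_def Y'_def X_def cos_squared_eq) (simp add: power2_eq_square algebra_simps)
  qed
  ultimately show ?thesis by (simp add: D_def)
qed

end

theorem theorem2:
  fixes \<beta> lam :: real and s :: complex
  assumes "lam \<ge> \<beta>" and "\<beta> > 0"
  shows "((\<lambda>\<theta>::real. complex_of_real ((cos \<theta>)\<^sup>2 / \<beta>\<^sup>2 + (sin \<theta>)\<^sup>2 / lam\<^sup>2) powr s)
            has_integral
          2 * complex_of_real pi * complex_of_real \<beta> / complex_of_real lam powr (1 + 2 * s)
            * hypergeo_2F1 (1 / 2) (1 + s) 1 (complex_of_real (1 - \<beta>\<^sup>2 / lam\<^sup>2)))
         {-pi..pi}"
proof -

  \<comment> \<open>Evaluation of the integral by substitution\<close>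
  define F where "F \<theta> = (cos \<theta>)\<^sup>2 / \<beta>\<^sup>2 + (sin \<theta>)\<^sup>2 / lam\<^sup>2" for \<theta>
  define r k where "r = lam / \<beta>" and "k = 1 - \<beta>\<^sup>2 / lam\<^sup>2"
  define C where "C = complex_of_real \<beta> / complex_of_real lam powr (1 + 2 * s)"
  define H where "H = hypergeo_2F1 (1/2) (1 + s) 1 (complex_of_real k)"
  have lam: "lam > 0" and r: "r > 0"
    using assms by (auto simp: r_def)
  have k: "0 \<le> k" "k < 1"
    using assms lam by (auto simp: k_def divide_le_eq)
  have F_pos: "F \<theta> > 0" for \<theta>
  proof -
    have "F \<theta> = ((cos \<theta>)\<^sup>2 + (\<beta>\<^sup>2 / lam\<^sup>2) * (sin \<theta>)\<^sup>2) / \<beta>\<^sup>2"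
      using assms lam by (simp add: F_def field_simps)
    then show ?thesis
      using cos_sin_squares_pos[of "\<beta>\<^sup>2 / lam\<^sup>2" \<theta>] assms lam by simp
  qed
  \<comment> \<open>The base is positive, so the power is an exponential of the real logarithm and
    the branch cut is never met.\<close>
  have cont: "continuous_on S (\<lambda>\<theta>. complex_of_real (F \<theta>) powr s)" for S
  proof -
    have "continuous_on S (\<lambda>\<theta>. exp (s * complex_of_real (ln (F \<theta>))))"
      using F_pos[unfolded F_def] assms lam unfolding F_def
      by (intro continuous_intros) (auto simp: less_imp_neq[symmetric] simp del: add_divide_distrib)
    then show ?thesis
      using F_pos by (simp add: powr_def Ln_of_real less_imp_neq[symmetric])
  qed
  have ends: "stretch_angle r (-pi) = -pi" "stretch_angle r pi = pi"
    by (simp_all add: stretch_angle_def)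
  \<comment> \<open>A crude bound suffices: the substitution rule asks only for an interval that
    contains the image and on which the integrand is continuous. The arctangent stays below
    \<open>pi / 2\<close> in absolute value.\<close>
  have range: "stretch_angle r ` {-pi..pi} \<subseteq> {-2*pi..2*pi}"
  proof clarify
    fix x assume "x \<in> {-pi..pi}"
    then show "stretch_angle r x \<in> {-2*pi..2*pi}"
      using arctan_bounded[of "(r - 1) * sin x * cos x / ((cos x)\<^sup>2 + r * (sin x)\<^sup>2)"]
      by (auto simp: stretch_angle_def)
  qed
  let ?D = "\<lambda>x. (cos x)\<^sup>2 + r\<^sup>2 * (sin x)\<^sup>2"
  have "((\<lambda>x. (r / ?D x) *\<^sub>R complex_of_real (F (stretch_angle r x)) powr s) has_integral
      integral {stretch_angle r (-pi)..stretch_angle r pi} (\<lambda>\<theta>. complex_of_real (F \<theta>) powr s)) {-pi..pi}"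
    by (rule has_integral_substitution[OF _ _ range])
       (auto simp: ends intro: cont DERIV_stretch_angle[OF r])
  \<comment> \<open>The Jacobian contributes the exponent -1 and \<open>F\<close> the exponent
    \<open>- s\<close>; the remaining powers of \<open>\<beta>\<close> and \<open>lam\<close> make
    up \<open>C\<close>.\<close>
  moreover have "(r / ?D x) *\<^sub>R complex_of_real (F (stretch_angle r x)) powr s
      = C * complex_of_real (1 - k * (cos x)\<^sup>2) powr (- (1 + s))" for x
  proof -
    define w where "w = 1 - k * (cos x)\<^sup>2"
    \<comment> \<open>This uses \<open>k = 1 - 1 / r^2\<close>.\<close>
    have D: "?D x = r\<^sup>2 * w"
      using assms lam by (simp add: w_def k_def r_def sin_squared_eq field_simps)
    have Dpos: "?D x > 0"
      using cos_sin_squares_pos[of "r\<^sup>2" x] r by simp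
    with D r have w: "w > 0"
      by (simp add: zero_less_mult_iff)
    have "F (stretch_angle r x) = ((cos x)\<^sup>2 / \<beta>\<^sup>2 + r\<^sup>2 * (sin x)\<^sup>2 / lam\<^sup>2) / ?D x"
      using Dpos
      by (simp add: F_def cos_sin_stretch_angle[OF r] power_divide power_mult_distrib add_divide_distrib
          mult.commute)
    \<comment> \<open>The choice \<open>r = lam / \<beta>\<close> gives both squares the same
      weight, so the numerator is constant.\<close>
    also have "(cos x)\<^sup>2 / \<beta>\<^sup>2 + r\<^sup>2 * (sin x)\<^sup>2 / lam\<^sup>2 = 1 / \<beta>\<^sup>2"
      using assms lam by (simp add: r_def power_divide flip: add_divide_distrib)
    finally have F: "F (stretch_angle r x) = 1 / (lam\<^sup>2 * w)"
      using assms unfolding D by (simp add: r_def power_divide)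
    have lnF: "ln (F (stretch_angle r x)) = - 2 * ln lam - ln w"
      using lam w by (simp add: F ln_div ln_mult ln_realpow)
    have "complex_of_real (F (stretch_angle r x)) powr s
        = 1 / (exp (2 * s * complex_of_real (ln lam)) * exp (s * complex_of_real (ln w)))"
      using F_pos[of "stretch_angle r x"]
      by (simp add: powr_def Ln_of_real lnF right_diff_distrib exp_diff exp_minus
          divide_inverse mult_ac)
    moreover have "r / ?D x = \<beta> / (lam * w)"
      using assms lam unfolding D by (simp add: r_def power2_eq_square)
    moreover have "complex_of_real lam powr (1 + 2 * s)
        = lam * exp (2 * s * complex_of_real (ln lam))"
      using lam by (simp add: powr_def Ln_of_real ring_distribs exp_add exp_of_real)
    moreover have "complex_of_real w powr (- (1 + s)) = 1 / (exp (s * complex_of_real (ln w)) * w)"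
      using w by (simp add: powr_def Ln_of_real ring_distribs exp_diff exp_of_real exp_minus field_simps)
    ultimately show ?thesis
      by (simp add: C_def w_def[symmetric] scaleR_conv_of_real mult_ac)
  qed
  ultimately have "((\<lambda>x. C * complex_of_real (1 - k * (cos x)\<^sup>2) powr (- (1 + s))) has_integral
      integral {-pi..pi} (\<lambda>\<theta>. complex_of_real (F \<theta>) powr s)) {-pi..pi}"
    by (simp add: ends)
  moreover have "((\<lambda>x. C * complex_of_real (1 - k * (cos x)\<^sup>2) powr (- (1 + s))) has_integral
      C * (2 * complex_of_real pi * H)) {-pi..pi}"
    unfolding H_def by (intro has_integral_mult_right has_integral_one_minus_cos_squared_powr k)
  ultimately have "integral {-pi..pi} (\<lambda>\<theta>. complex_of_real (F \<theta>) powr s)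
      = C * (2 * complex_of_real pi * H)"
    by (rule has_integral_unique)
  \<comment> \<open>So far only the value of \<open>integral\<close> is known; continuity supplies
    integrability.\<close>
  with integrable_integral[OF integrable_continuous_real[OF cont]]
  have "((\<lambda>\<theta>. complex_of_real (F \<theta>) powr s) has_integral C * (2 * complex_of_real pi * H)) {-pi..pi}"
    by metis
  then show ?thesis
    unfolding F_def C_def H_def k_def by (simp add: mult_ac)
qed

end
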